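(* Let $n\in\mathbb{N}$, let $\mu$ be a finite measure on $\mathcal{T}=[0,1]$, and let $\bar t=(t_0,\ldots,t_{n-1})\in\mathcal{T}^{n}$. For every two mixed-consumption Nash equilibria $s,s'$ in the $n$-producers consumer game $(\mu;\bar t)$, every $d\in\mathcal{T}$, every $k\in\operatorname{supp}(s(d))$ and every $k'\in\operatorname{supp}(s'(d))$, we have $\ell^s_k=\ell^{s'}_{k'}$.
   Context: Notation: $\mathbb{N}=\{0,1,2,\ldots\}$, $\mathcal{T}=[0,1]$ (with the Borel $\sigma$-algebra), $\mathbb{P}_n=\{0,1,\ldots,n-1\}$. Consumer game $(\mu;\bar t)$. Consumers form a continuum; consumer types $d\in\mathcal{T}$ are distributed according to the finite measure $\mu$. Producer $j\in\mathbb{P}_n$ has level $t_j\in\mathcal{T}$. The strategies available to type $d$ are $S_d=\{j\in\mathbb{P}_n\mid t_j\le d\}\cup\{\lnot\}$, where $\lnot$ is a symbol meaning "not consuming". Put $S=\mathbb{P}_n\cup\{\lnot\}$ and, for nonempty $S'\subseteq S$, $\Delta^{S'}=\{x\in[0,1]^S\mid \sum_{j\in S'}x_j=1,\ x_j=0 \text{ for } j\in S\setminus S'\}$. A mixed-consumption profile is a measurable function $s:\mathcal{T}\to[0,1]^S$ with $s(d)\in\Delta^{S_d}$ for every $d\in\mathcal{T}$; its loads are $\ell^s_j=\int_{\mathcal{T}}s_j\,d\mu$ for $j\in S$ (including $j=\lnot$). It is a mixed-consumption Nash equilibrium if for every $d\in\mathcal{T}$: (a) $\lnot\in\operatorname{supp}(s(d))$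 only if $S_d=\{\lnot\}$; and (b) $\ell^s_k\le\ell^s_j$ for every $k\in\operatorname{supp}(s(d))$ and every $j\in S_d\setminus\{\lnot\}$. Here $\operatorname{supp}(s(d))=\{k\in S\mid s_k(d)>0\}$. *)

theory Defs
  imports "HOL-Analysis.Analysis"
begin

text \<open>
  The symbol for not consuming is encoded as \<open>None\<close>, producer \<open>j\<close> as \<open>Some j\<close>.
\<close>

abbreviation not_consume :: "nat option" where
  "not_consume \<equiv> None"

definition type_space :: "real measure" where
  "type_space = restrict_space borel {0..1}"

definition strategies :: "nat \<Rightarrow> nat option set" where
  "strategies n = Some ` {..<n} \<union> {not_consume}"

definition available :: "nat \<Rightarrow> (nat \<Rightarrow> real) \<Rightarrow> real \<Rightarrow> nat option set" where
  "available n t d = Some ` {j \<in> {..<n}. t j \<le> d} \<union> {not_consume}"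

text \<open>
  Elements of \<open>[0,1]\<^sup>S\<close> are extensional functions (equal to \<open>undefined\<close> off \<open>S\<close>),
  so that they are determined by their values on \<open>S\<close>.
\<close>

definition mixed_simplex :: "nat \<Rightarrow> nat option set \<Rightarrow> (nat option \<Rightarrow> real) set" where
  "mixed_simplex n S' =
     {x \<in> strategies n \<rightarrow>\<^sub>E {0..1}.
        (\<Sum>j\<in>S'. x j) = 1 \<and> (\<forall>j\<in>strategies n - S'. x j = 0)}"

definition mixed_profile ::
  "nat \<Rightarrow> (nat \<Rightarrow> real) \<Rightarrow> (real \<Rightarrow> nat option \<Rightarrow> real) \<Rightarrow> bool" where
  "mixed_profile n t s \<longleftrightarrow>
     s \<in> measurable type_space (\<Pi>\<^sub>M j\<in>strategies n. restrict_space borel {0..1}) \<and>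
     (\<forall>d\<in>{0..1}. s d \<in> mixed_simplex n (available n t d))"

definition load :: "real measure \<Rightarrow> (real \<Rightarrow> nat option \<Rightarrow> real) \<Rightarrow> nat option \<Rightarrow> real" where
  "load \<mu> s j = (\<integral>d. s d j \<partial>\<mu>)"

definition mixed_supp :: "nat \<Rightarrow> (nat option \<Rightarrow> real) \<Rightarrow> nat option set" where
  "mixed_supp n x = {k \<in> strategies n. x k > 0}"

definition mixed_nash ::
  "nat \<Rightarrow> real measure \<Rightarrow> (nat \<Rightarrow> real) \<Rightarrow> (real \<Rightarrow> nat option \<Rightarrow> real) \<Rightarrow> bool" where
  "mixed_nash n \<mu> t s \<longleftrightarrow>
     mixed_profile n t s \<and>
     (\<forall>d\<in>{0..1}.
        (not_consume \<in> mixed_supp n (s d) \<longrightarrow> available n t d = {not_consume}) \<and>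
        (\<forall>k\<in>mixed_supp n (s d). \<forall>j\<in>available n t d - {not_consume}.
           load \<mu> s k \<le> load \<mu> s j))"

text \<open>
  The Bochner integral defaults to \<open>0\<close> for non-integrable functions; this never
  happens for the loads of a profile.
\<close>

lemma mixed_profile_integrable:
  assumes "finite_measure \<mu>" and sets: "sets \<mu> = sets type_space"
    and s: "mixed_profile n t s" and j: "j \<in> strategies n"
  shows "integrable \<mu> (\<lambda>d. s d j)"
proof -
  interpret finite_measure \<mu> by fact
  have space: "space \<mu> = {0..1}"
    using sets_eq_imp_space_eq[OF sets] by (simp add: type_space_def space_restrict_space)
  have "s \<in> measurable \<mu> (\<Pi>\<^sub>M j\<in>strategies n. restrict_space borel {0..1})"
    using s measurable_cong_sets[OF sets refl] by (auto simp: mixed_profile_def)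
  from measurable_compose[OF this measurable_component_singleton[OF j]]
  have "(\<lambda>d. s d j) \<in> measurable \<mu> (restrict_space borel {0..1})" .
  then have meas: "(\<lambda>d. s d j) \<in> borel_measurable \<mu>"
    by (simp add: measurable_restrict_space2_iff)
  have "s d j \<in> {0..1}" if "d \<in> space \<mu>" for d
    using s j that space by (auto simp: mixed_profile_def mixed_simplex_def PiE_iff)
  then show ?thesis
    by (intro integrable_const_bound[where B = 1] meas AE_I2) auto
qed

end

theory Submission
  imports Defs
begin

text \<open>
  The loads of an equilibrium are unique. An equilibrium \<open>s\<close> puts, for every type, all its mass on
  producers of minimal load, so \<open>\<Sum>\<^sub>j s\<^sub>j(d) \<ell>\<^sub>j \<le> \<Sum>\<^sub>j s'\<^sub>j(d) \<ell>\<^sub>j\<close> for every other profile \<open>s'\<close> with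
  the same consumption mass. Integrating gives
  \<open>\<Sum>\<^sub>j \<ell>\<^sub>j \<ell>\<^sub>j \<le> \<Sum>\<^sub>j \<ell>'\<^sub>j \<ell>\<^sub>j\<close>; adding the same inequality with the roles of \<open>s\<close> and \<open>s'\<close> exchanged
  yields \<open>\<Sum>\<^sub>j (\<ell>\<^sub>j - \<ell>'\<^sub>j)\<^sup>2 \<le> 0\<close>. The loads being equal, so are their minima over
  the strategies available to a type.
\<close>

text \<open>As both weights have total mass 1, each side can be multiplied by the total mass of the
  other weight. Both become double sums over pairs \<open>(i, j)\<close> with coefficient
  \<open>x i * y j\<close>, and these are compared term by term.\<close>

lemma weighted_sum_minimal_le:
  fixes x y L :: "'a \<Rightarrow> real"
  assumes "sum x A = 1" "sum y A = 1"
    and x: "\<And>i. i \<in> A \<Longrightarrow> 0 \<le> x i" and y: "\<And>i. i \<in> A \<Longrightarrow> 0 \<le> y i"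
    and min: "\<And>i j. i \<in> A \<Longrightarrow> j \<in> A \<Longrightarrow> 0 < x i \<Longrightarrow> L i \<le> L j"
  shows "(\<Sum>i\<in>A. x i * L i) \<le> (\<Sum>i\<in>A. y i * L i)"
proof -
  have "(\<Sum>i\<in>A. x i * L i) = (\<Sum>i\<in>A. \<Sum>j\<in>A. y j * (x i * L i))"
    using assms(2) by (simp flip: sum_distrib_right)
  also have "\<dots> \<le> (\<Sum>i\<in>A. \<Sum>j\<in>A. y j * (x i * L j))"
  proof (intro sum_mono)
    fix i j assume "i \<in> A" "j \<in> A"
    then show "y j * (x i * L i) \<le> y j * (x i * L j)"
      \<comment> \<open>Minimality is available only where \<open>x i\<close> is positive; where
        \<open>x i = 0\<close> both terms vanish.\<close>
      using x[of i] y[of j] min[of i j] by (cases "x i = 0") (auto intro!: mult_left_mono)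
  qed
  also have "\<dots> = (\<Sum>j\<in>A. \<Sum>i\<in>A. x i * (y j * L j))"
    by (subst sum.swap) (simp add: mult_ac)
  also have "\<dots> = (\<Sum>j\<in>A. y j * L j)"
    using assms(1) by (simp flip: sum_distrib_right)
  finally show ?thesis .
qed

lemma available_subset_strategies: "available n t d \<subseteq> strategies n"
  by (auto simp: available_def strategies_def)

lemma finite_strategies: "finite (strategies n)"
  by (simp add: strategies_def)

lemma not_consume_available: "not_consume \<in> available n t d"
  by (simp add: available_def)

lemma mixed_profile_simplex:
  assumes "mixed_profile n t s" "d \<in> {0..1}"
  shows "\<And>j. j \<in> strategies n \<Longrightarrow> 0 \<le> s d j"
    and "\<And>j. j \<in> strategies n \<Longrightarrow> j \<notin> available n t d \<Longrightarrow> s d j = 0"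
    and "(\<Sum>j\<in>available n t d. s d j) = 1"
  using assms by (auto simp: mixed_profile_def mixed_simplex_def PiE_iff)

lemma mixed_supp_available:
  assumes "mixed_profile n t s" "d \<in> {0..1}"
  shows "mixed_supp n (s d) \<subseteq> available n t d"
  using mixed_profile_simplex(2)[OF assms] by (fastforce simp: mixed_supp_def)

lemma mixed_nash_profile: "mixed_nash n \<mu> t s \<Longrightarrow> mixed_profile n t s"
  by (simp add: mixed_nash_def)

text \<open>The value depends on \<open>d\<close> and \<open>t\<close> alone. Hence all equilibria
  agree on the mass of non-consumption, and each type puts the same total mass on producers in all
  of them.\<close>

lemma mixed_nash_not_consume:
  assumes nash: "mixed_nash n \<mu> t s" and d: "d \<in> {0..1}"
  shows "s d not_consume = (if available n t d = {not_consume} then 1 else 0)"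
proof (cases "available n t d = {not_consume}")
  case True
  then show ?thesis
    using mixed_profile_simplex(3)[of n t s d] nash d by (simp add: mixed_nash_def)
next
  case False
  have strat: "not_consume \<in> strategies n" by (simp add: strategies_def)
  have "0 \<le> s d not_consume"
    using mixed_profile_simplex(1)[OF mixed_nash_profile[OF nash] d strat] .
  moreover have "not_consume \<notin> mixed_supp n (s d)"
    using False nash d by (auto simp: mixed_nash_def)
  ultimately show ?thesis
    using False strat by (auto simp: mixed_supp_def)
qed

lemma mixed_nash_sum_producers:
  assumes nash: "mixed_nash n \<mu> t s" and d: "d \<in> {0..1}"
    and "available n t d \<noteq> {not_consume}"
  shows "(\<Sum>j\<in>available n t d - {not_consume}. s d j) = 1"
  using mixed_profile_simplex(3)[of n t s d] mixed_nash_not_consume[OF nash d] assms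
    finite_subset[OF available_subset_strategies finite_strategies, of n t d]
  by (simp add: sum_diff1 not_consume_available mixed_nash_def)

text \<open>The sums range over all producers, not just the available ones, so that the index set
  does not vary with \<open>d\<close> when the inequality is integrated. Only the mass that
  \<open>s'\<close> puts on producers matters, so \<open>s'\<close> may be an equilibrium for
  another measure.\<close>

lemma mixed_nash_weighted_load_le:
  assumes nash: "mixed_nash n \<mu> t s" "mixed_nash n \<nu> t s'" and d: "d \<in> {0..1}"
  shows "(\<Sum>j\<in>strategies n - {not_consume}. s d j * load \<mu> s j)
    \<le> (\<Sum>j\<in>strategies n - {not_consume}. s' d j * load \<mu> s j)"
proof -
  let ?A = "available n t d - {not_consume}"
  have prof: "mixed_profile n t s" "mixed_profile n t s'"
    using nash by (simp_all add: mixed_nash_profile)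
  have sub: "?A \<subseteq> strategies n"
    using available_subset_strategies by fast
  have restrict: "(\<Sum>j\<in>strategies n - {not_consume}. r d j * load \<mu> s j)
      = (\<Sum>j\<in>?A. r d j * load \<mu> s j)" if "mixed_profile n t r" for r
    using mixed_profile_simplex(2)[OF that d] available_subset_strategies[of n t d]
    by (intro sum.mono_neutral_right) (auto simp: finite_strategies)
  have "(\<Sum>j\<in>?A. s d j * load \<mu> s j) \<le> (\<Sum>j\<in>?A. s' d j * load \<mu> s j)"
  \<comment> \<open>A type that can only abstain has no available producer, so both sums are empty.
    Otherwise both profiles put mass 1 on the available producers.\<close>
  proof (cases "available n t d = {not_consume}")
    case False
    show ?thesis
    proof (rule weighted_sum_minimal_le)
      fix i j assume "i \<in> ?A" "j \<in> ?A" "0 < s d i"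
      then show "load \<mu> s i \<le> load \<mu> s j"
        using nash(1) d sub by (auto simp: mixed_nash_def mixed_supp_def)
    qed (use False mixed_nash_sum_producers nash d sub mixed_profile_simplex(1) prof in blast)+
  qed simp
  then show ?thesis
    by (simp add: restrict prof)
qed

lemma mixed_nash_load_le:
  assumes fin: "finite_measure \<mu>" and sets: "sets \<mu> = sets type_space"
    and nash: "mixed_nash n \<mu> t s" "mixed_nash n \<mu> t s'"
  shows "(\<Sum>j\<in>strategies n - {not_consume}. load \<mu> s j * load \<mu> s j)
    \<le> (\<Sum>j\<in>strategies n - {not_consume}. load \<mu> s' j * load \<mu> s j)"
proof -
  let ?P = "strategies n - {not_consume}"
  have space: "space \<mu> = {0..1}"
    using sets_eq_imp_space_eq[OF sets] by (simp add: type_space_def space_restrict_space)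
  have int: "integrable \<mu> (\<lambda>d. r d j * load \<mu> s j)"
    if "mixed_nash n \<mu> t r" "j \<in> ?P" for r j
    using that mixed_profile_integrable[OF fin sets mixed_nash_profile] by simp
  \<comment> \<open>The loads of \<open>s\<close> act as constant prices: integrating over types
    turns only the factor \<open>r d j\<close> into a load. With \<open>r\<close> equal to
    \<open>s'\<close> this gives the mixed products.\<close>
  have eq: "(\<integral>d. (\<Sum>j\<in>?P. r d j * load \<mu> s j) \<partial>\<mu>) = (\<Sum>j\<in>?P. load \<mu> r j * load \<mu> s j)"
    if "mixed_nash n \<mu> t r" for r
    using int[OF that] by (simp add: load_def)
  have "(\<integral>d. (\<Sum>j\<in>?P. s d j * load \<mu> s j) \<partial>\<mu>) \<le> (\<integral>d. (\<Sum>j\<in>?P. s' d j * load \<mu> s j) \<partial>\<mu>)"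
    using mixed_nash_weighted_load_le[OF nash] int nash space
    by (intro integral_mono Bochner_Integration.integrable_sum) auto
  then show ?thesis
    by (simp only: eq nash)
qed

lemma mixed_nash_load_unique:
  assumes fin: "finite_measure \<mu>" and sets: "sets \<mu> = sets type_space"
    and nash: "mixed_nash n \<mu> t s" "mixed_nash n \<mu> t s'"
    and j: "j \<in> strategies n"
  shows "load \<mu> s j = load \<mu> s' j"
proof (cases "j = not_consume")
  \<comment> \<open>Abstention lies outside the quadratic argument, but here the two integrands
    already agree at every type.\<close>
  case True
  have "space \<mu> = {0..1}"
    using sets_eq_imp_space_eq[OF sets] by (simp add: type_space_def space_restrict_space)
  then show ?thesis
    unfolding load_def True
    by (intro Bochner_Integration.integral_cong refl)
       (simp only: mixed_nash_not_consume[OF nash(1)] mixed_nash_not_consume[OF nash(2)])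
next
  case False
  let ?P = "strategies n - {not_consume}"
  \<comment> \<open>The square is expanded so that the first difference is bounded by the inequality
    for \<open>s\<close> and the second by the one for \<open>s'\<close>.\<close>
  have "(\<Sum>j\<in>?P. (load \<mu> s j - load \<mu> s' j)\<^sup>2) =
      (\<Sum>j\<in>?P. load \<mu> s j * load \<mu> s j) - (\<Sum>j\<in>?P. load \<mu> s' j * load \<mu> s j)
      + ((\<Sum>j\<in>?P. load \<mu> s' j * load \<mu> s' j) - (\<Sum>j\<in>?P. load \<mu> s j * load \<mu> s' j))"
    unfolding sum_subtractf[symmetric] sum.distrib[symmetric]
    by (intro sum.cong refl) (simp add: power2_eq_square algebra_simps)
  also have "\<dots> \<le> 0"
    using mixed_nash_load_le[OF fin sets nash] mixed_nash_load_le[OF fin sets nash(2,1)] by simp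
  finally have "(\<Sum>j\<in>?P. (load \<mu> s j - load \<mu> s' j)\<^sup>2) = 0"
    by (intro antisym sum_nonneg) auto
  then show ?thesis
    using False j by (simp add: sum_nonneg_eq_0_iff finite_strategies)
qed

theorem corollary3p12:
  fixes n :: nat and \<mu> :: "real measure" and t :: "nat \<Rightarrow> real"
    and s s' :: "real \<Rightarrow> nat option \<Rightarrow> real"
    and d :: real and k k' :: "nat option"
  assumes "finite_measure \<mu>" and "sets \<mu> = sets type_space"
    and "\<And>j. j < n \<Longrightarrow> t j \<in> {0..1}"
    and "mixed_nash n \<mu> t s" and "mixed_nash n \<mu> t s'"
    and "d \<in> {0..1}"
    and "k \<in> mixed_supp n (s d)" and "k' \<in> mixed_supp n (s' d)"
  shows "load \<mu> s k = load \<mu> s' k'"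
proof -
  have k: "k \<in> available n t d" and k': "k' \<in> available n t d"
    using assms(4-8) mixed_supp_available[OF mixed_nash_profile] by blast+
  have unique: "load \<mu> s j = load \<mu> s' j" if "j \<in> available n t d" for j
    using that available_subset_strategies mixed_nash_load_unique[OF assms(1,2,4,5)] by blast
  show ?thesis
  \<comment> \<open>If abstaining is the only option, \<open>k\<close> and \<open>k'\<close>
    coincide. Otherwise both are producers, so each can serve as the alternative to the other in the
    equilibrium condition.\<close>
  proof (cases "available n t d = {not_consume}")
    case True
    then show ?thesis using k k' unique by simp
  next
    case False
    then have "k \<noteq> not_consume" "k' \<noteq> not_consume"
      using assms(4-8) by (auto simp: mixed_nash_def)
    with k k' have "load \<mu> s k \<le> load \<mu> s k'" "load \<mu> s' k' \<le> load \<mu> s' k"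
      using assms(4-8) by (auto simp: mixed_nash_def)
    then show ?thesis
      using unique[OF k] unique[OF k'] by simp
  qed
qed

end
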